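(* For every sufficiently small $\varepsilon>0$ there exist an instance of the hereditary maximin share problem (agents, items, a hereditary set system and nonnegative item values, as in the context) with ${\tt MMS}(i)=1$ for every agent $i$, a choice of maximin partitions, and a valid execution of the Fair Division Procedure with target value $\alpha=\frac{40}{107}+\varepsilon$ in which at least one agent is not allocated any bundle. In this sense the performance guarantee of the procedure is at most $\frac{40}{107}$.
   Context: A hereditary set system $H=(J,\mathcal{F})$ consists of a finite set $J$ of items and a nonempty family $\mathcal{F}$ of subsets of $J$ such that $S\in\mathcal{F}$ and $T\subseteq S$ imply $T\in\mathcal{F}$. There is a set $I$ of $n$ agents; agent $i$ has a nonnegative value $v_{i,j}$ for each item $j$, and $v_i(S)=\max_{T\in\mathcal{F},\,T\subseteq S}\sum_{j\in T}v_{i,j}$ for $S\subseteq J$. The maximin share ${\tt MMS}(i)$ is the maximum, over partitions of $J$ into $n$ parts, of the minimum value $v_i$ of a part; a partition attaining it is a maximin partition for $i$. Fair Division Procedure with target $\alpha$: (1) for each agent $i$ fix a maximin partition $\mathcal{P}_i$; for an item $j$ in part $P\in\mathcal{P}_i$ set $\hat v_{i,j}=v_{i,j}/v_i(P)$ and $\hat v_i(S)=\max_{T\in\mathcal{F},T\subseteq S}\sum_{j\in T}\hat v_{i,j}$. (2) Let $I$ be all agents and $J$ all items; for $\tau=1,\dots,|J|$: while there exist $S\subseteq J$ with $|S|=\tau$ and $i\in I$ with $\hat v_i(S)\ge\alpha$, choose any such pair, allocate $S$ to $i$, and set $I\leftarrow I\setminus\{i\}$, $J\leftarrow J\setminus S$.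 A valid execution is any run of this procedure for some choice of the pairs $(S,i)$. *)

theory Defs
  imports Complex_Main "HOL-Library.Disjoint_Sets"
begin

definition hereditary_system :: "'j set \<Rightarrow> 'j set set \<Rightarrow> bool" where
  "hereditary_system J F \<longleftrightarrow>
     finite J \<and> F \<subseteq> Pow J \<and> F \<noteq> {} \<and> (\<forall>S\<in>F. \<forall>T. T \<subseteq> S \<longrightarrow> T \<in> F)"

definition hereditary_instance ::
    "'i set \<Rightarrow> 'j set \<Rightarrow> 'j set set \<Rightarrow> ('i \<Rightarrow> 'j \<Rightarrow> real) \<Rightarrow> bool" where
  "hereditary_instance I J F v \<longleftrightarrow>
     finite I \<and> hereditary_system J F \<and> (\<forall>i\<in>I. \<forall>j\<in>J. 0 \<le> v i j)"

text \<open>The argument \<open>u\<close> gives the item values of a single agent.\<close>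

definition set_value :: "'j set set \<Rightarrow> ('j \<Rightarrow> real) \<Rightarrow> 'j set \<Rightarrow> real" where
  "set_value F u S = Max {\<Sum>j\<in>T. u j | T. T \<in> F \<and> T \<subseteq> S}"

text \<open>
  A partition into \<open>n\<close> parts is a disjoint family indexed by \<open>{..<n}\<close>; parts may be empty,
  so that partitions exist even if there are fewer than \<open>n\<close> items.
  The values of the family outside \<open>{..<n}\<close> are irrelevant.
\<close>

definition is_partition :: "nat \<Rightarrow> 'j set \<Rightarrow> (nat \<Rightarrow> 'j set) \<Rightarrow> bool" where
  "is_partition n J P \<longleftrightarrow> disjoint_family_on P {..<n} \<and> (\<Union>k<n. P k) = J"

definition min_part_value :: "nat \<Rightarrow> 'j set set \<Rightarrow> ('j \<Rightarrow> real) \<Rightarrow> (nat \<Rightarrow> 'j set) \<Rightarrow> real" where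
  "min_part_value n F u P = Min ((\<lambda>k. set_value F u (P k)) ` {..<n})"

definition MMS :: "nat \<Rightarrow> 'j set \<Rightarrow> 'j set set \<Rightarrow> ('j \<Rightarrow> real) \<Rightarrow> real" where
  "MMS n J F u = Max {min_part_value n F u P | P. is_partition n J P}"

definition maximin_partition ::
    "nat \<Rightarrow> 'j set \<Rightarrow> 'j set set \<Rightarrow> ('j \<Rightarrow> real) \<Rightarrow> (nat \<Rightarrow> 'j set) \<Rightarrow> bool" where
  "maximin_partition n J F u P \<longleftrightarrow>
     is_partition n J P \<and> min_part_value n F u P = MMS n J F u"

definition scaled_value ::
    "nat \<Rightarrow> 'j set set \<Rightarrow> ('j \<Rightarrow> real) \<Rightarrow> (nat \<Rightarrow> 'j set) \<Rightarrow> 'j \<Rightarrow> real" where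
  "scaled_value n F u P j = u j / set_value F u (P (THE k. k < n \<and> j \<in> P k))"

text \<open>
  A state of the procedure consists of the remaining agents, the remaining items, and the bundles
  allocated so far. The parameter \<open>w\<close> stands for the scaled item values of all agents.
\<close>

type_synonym ('i, 'j) state = "'i set \<times> 'j set \<times> ('i \<rightharpoonup> 'j set)"

definition eligible ::
    "'j set set \<Rightarrow> ('i \<Rightarrow> 'j \<Rightarrow> real) \<Rightarrow> real \<Rightarrow> nat \<Rightarrow> 'i set \<Rightarrow> 'j set \<Rightarrow> 'j set \<Rightarrow> 'i \<Rightarrow> bool" where
  "eligible F w \<alpha> \<tau> I J S i \<longleftrightarrow>
     S \<subseteq> J \<and> card S = \<tau> \<and> i \<in> I \<and> set_value F (w i) S \<ge> \<alpha>"

inductive while_loop ::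
    "'j set set \<Rightarrow> ('i \<Rightarrow> 'j \<Rightarrow> real) \<Rightarrow> real \<Rightarrow> nat \<Rightarrow> ('i, 'j) state \<Rightarrow> ('i, 'j) state \<Rightarrow> bool"
  for F w \<alpha> \<tau> where
  stop: "(\<nexists>S i. eligible F w \<alpha> \<tau> I J S i) \<Longrightarrow> while_loop F w \<alpha> \<tau> (I, J, A) (I, J, A)"
| step: "eligible F w \<alpha> \<tau> I J S i \<Longrightarrow>
         while_loop F w \<alpha> \<tau> (I - {i}, J - S, A(i \<mapsto> S)) s \<Longrightarrow>
         while_loop F w \<alpha> \<tau> (I, J, A) s"

primrec for_loop ::
    "'j set set \<Rightarrow> ('i \<Rightarrow> 'j \<Rightarrow> real) \<Rightarrow> real \<Rightarrow> nat list \<Rightarrow> ('i, 'j) state \<Rightarrow> ('i, 'j) state \<Rightarrow> bool"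
where
  "for_loop F w \<alpha> [] s s' \<longleftrightarrow> s' = s"
| "for_loop F w \<alpha> (\<tau> # \<tau>s) s s' \<longleftrightarrow> (\<exists>t. while_loop F w \<alpha> \<tau> s t \<and> for_loop F w \<alpha> \<tau>s t s')"

text \<open>
  \<open>P i\<close> is the maximin partition fixed for agent \<open>i\<close>, and \<open>A\<close> is the final allocation of some
  run; \<open>A i = None\<close> means that agent \<open>i\<close> receives no bundle.
\<close>

definition valid_execution ::
    "'i set \<Rightarrow> 'j set \<Rightarrow> 'j set set \<Rightarrow> ('i \<Rightarrow> 'j \<Rightarrow> real) \<Rightarrow> ('i \<Rightarrow> nat \<Rightarrow> 'j set) \<Rightarrow> real \<Rightarrow>
     ('i \<rightharpoonup> 'j set) \<Rightarrow> bool" where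
  "valid_execution I J F v P \<alpha> A \<longleftrightarrow>
     (\<forall>i\<in>I. maximin_partition (card I) J F (v i) (P i)) \<and>
     (\<exists>I' J'. for_loop F (\<lambda>i. scaled_value (card I) F (v i) (P i)) \<alpha> [1..<Suc (card J)]
                (I, J, Map.empty) (I', J', A))"

end

theory Submission
  imports Defs
begin

text \<open>
  All agents have the same values. In units of \<open>1/107\<close>, each of 240 parts of value 107 has items of
  value \<open>40\<close>, \<open>40/2\<close>, \<open>40/9\<close> and 16 equal items of value slightly below \<open>40/15\<close>. Apart from
  the subsets of the parts, only transversal bundles are feasible: 2 items of the first kind, 3 of
  the second, 10 of the third, or 16 of the last, taken from different parts. A proper
  subset of a transversal bundle is worth at most 40, so the transversal bundles survive until the
  phase of their own size. Removing one item of each of the four kinds from every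
  part leaves 15 items, worth less than 40, in each part, and takes
  \<open>240 * (1/2 + 1/3 + 1/10 + 1/16) = 239\<close> bundles.
\<close>

section \<open>Set values and maximin shares\<close>

lemma set_value_candidates_finite:
  assumes "finite F"
  shows "finite {\<Sum>j\<in>T. u j | T. T \<in> F \<and> T \<subseteq> S}"
proof -
  have "{\<Sum>j\<in>T. u j | T. T \<in> F \<and> T \<subseteq> S} \<subseteq> sum u ` F" by auto
  then show ?thesis using assms finite_surj by blast
qed

lemma set_value_attained:
  assumes "finite F" "{} \<in> F"
  obtains T where "T \<in> F" "T \<subseteq> S" "set_value F u S = sum u T"
proof -
  let ?X = "{\<Sum>j\<in>T. u j | T. T \<in> F \<and> T \<subseteq> S}"
  have "sum u {} \<in> ?X" using assms(2) by blast
  then have "Max ?X \<in> ?X" using set_value_candidates_finite[OF assms(1)] by (intro Max_in) auto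
  then show ?thesis using that unfolding set_value_def by blast
qed

lemma sum_le_set_value:
  assumes "finite F" "T \<in> F" "T \<subseteq> S"
  shows "sum u T \<le> set_value F u S"
  unfolding set_value_def using assms
  by (intro Max_ge set_value_candidates_finite) auto

lemma set_value_le_sum:
  assumes "finite F" "{} \<in> F" "finite S" "\<And>j. j \<in> S \<Longrightarrow> 0 \<le> u j"
  shows "set_value F u S \<le> sum u S"
proof -
  obtain T where "T \<in> F" "T \<subseteq> S" "set_value F u S = sum u T"
    using set_value_attained[OF assms(1,2)] .
  then show ?thesis using assms(3,4) by (auto intro: sum_mono2)
qed

lemma set_value_feasible:
  assumes "finite F" "{} \<in> F" "S \<in> F" "finite S" "\<And>j. j \<in> S \<Longrightarrow> 0 \<le> u j"
  shows "set_value F u S = sum u S"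
  using set_value_le_sum[OF assms(1,2,4,5)] sum_le_set_value[OF assms(1,3) order_refl]
  by (intro antisym) auto

lemma set_value_cong:
  assumes "\<And>T j. T \<in> F \<Longrightarrow> j \<in> T \<Longrightarrow> u j = u' j"
  shows "set_value F u S = set_value F u' S"
proof -
  have "sum u T = sum u' T" if "T \<in> F" for T using assms that by (intro sum.cong) auto
  then have "{\<Sum>j\<in>T. u j | T. T \<in> F \<and> T \<subseteq> S} = {\<Sum>j\<in>T. u' j | T. T \<in> F \<and> T \<subseteq> S}"
    by (metis (lifting))
  then show ?thesis unfolding set_value_def by simp
qed

lemma hereditary_system_finite:
  assumes "hereditary_system J F"
  shows "finite J" "finite F" "{} \<in> F"
proof -
  show fJ: "finite J" using assms unfolding hereditary_system_def by simp
  show "finite F" using assms fJ finite_subset[of F "Pow J"] unfolding hereditary_system_def by simp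
  show "{} \<in> F" using assms unfolding hereditary_system_def by blast
qed

text \<open>The minimum is at most the average, and by nonnegativity each part is worth at most the
  sum of its items.\<close>

lemma min_part_value_le_average:
  assumes her: "hereditary_system J F" and nonneg: "\<And>j. j \<in> J \<Longrightarrow> 0 \<le> u j"
    and n: "0 < n" and part: "is_partition n J P"
  shows "real n * min_part_value n F u P \<le> sum u J"
proof -
  note fin = hereditary_system_finite[OF her]
  have disj: "disjoint_family_on P {..<n}" and un: "(\<Union>k<n. P k) = J"
    using part unfolding is_partition_def by auto
  have sub: "P k \<subseteq> J" if "k < n" for k using un that by blast
  have "real n * min_part_value n F u P = (\<Sum>k<n. min_part_value n F u P)" by simp
  also have "\<dots> \<le> (\<Sum>k<n. set_value F u (P k))"
    unfolding min_part_value_def by (intro sum_mono Min_le) auto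
  also have "\<dots> \<le> (\<Sum>k<n. sum u (P k))"
    using sub nonneg fin by (intro sum_mono set_value_le_sum) (auto intro: finite_subset)
  also have "\<dots> = sum u (\<Union>k<n. P k)"
    using disj finite_subset[OF sub fin(1)] unfolding disjoint_family_on_def
    by (subst sum.UNION_disjoint) auto
  finally show ?thesis using un by simp
qed

text \<open>By the average bound, no partition can beat one whose parts share the total value
  equally.\<close>

lemma MMS_eqI:
  assumes her: "hereditary_system J F" and nonneg: "\<And>j. j \<in> J \<Longrightarrow> 0 \<le> u j"
    and n: "0 < n" and part: "is_partition n J P"
    and val: "\<And>k. k < n \<Longrightarrow> set_value F u (P k) = c" and total: "sum u J = real n * c"
  shows "MMS n J F u = c" "maximin_partition n J F u P"
proof -
  note fin = hereditary_system_finite[OF her]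
  let ?X = "{min_part_value n F u P | P. is_partition n J P}"
  have "(\<lambda>k. set_value F u (P k)) ` {..<n} = {c}" using val n by force
  then have c: "min_part_value n F u P = c" unfolding min_part_value_def by simp
  \<comment> \<open>Partition functions are arbitrary outside \<open>{..<n}\<close>, so there are
    infinitely many. Their minima are still sums over members of the finite family \<open>F\<close>,
    so \<open>Max\<close> is taken over a finite set.\<close>
  have "min_part_value n F u Q \<in> sum u ` F" for Q
  proof -
    have "min_part_value n F u Q \<in> (\<lambda>k. set_value F u (Q k)) ` {..<n}"
      unfolding min_part_value_def using n by (intro Min_in) auto
    then obtain k where "min_part_value n F u Q = set_value F u (Q k)" by blast
    then show ?thesis using set_value_attained[OF fin(2,3)] by (metis imageI)
  qed
  then have "?X \<subseteq> sum u ` F" by blast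
  then have "finite ?X" using fin(2) finite_surj by blast
  moreover have "x \<le> c" if x: "x \<in> ?X" for x
  proof -
    obtain Q where Q: "is_partition n J Q" "x = min_part_value n F u Q" using x by blast
    then have "real n * x \<le> real n * c"
      using min_part_value_le_average[where u = u, OF her nonneg n Q(1)] total Q(2) by simp
    then show ?thesis using n by simp
  qed
  moreover have "c \<in> ?X" using c part by blast
  ultimately show mms: "MMS n J F u = c" unfolding MMS_def by (intro Max_eqI)
  show "maximin_partition n J F u P" unfolding maximin_partition_def using part c mms by simp
qed

lemma scaled_value_unit_parts:
  assumes "is_partition n J P" "\<And>k. k < n \<Longrightarrow> set_value F u (P k) = 1" "j \<in> J"
  shows "scaled_value n F u P j = u j"
proof -
  have "\<exists>!k. k < n \<and> j \<in> P k"
    using assms(1,3) unfolding is_partition_def disjoint_family_on_def by blast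
  from theI'[OF this] have "(THE k. k < n \<and> j \<in> P k) < n" by simp
  then show ?thesis unfolding scaled_value_def using assms(2) by simp
qed

section \<open>Runs of the procedure\<close>

text \<open>Agents \<open>a\<close>, ..., \<open>a + q - 1\<close> receive \<open>B 0\<close>, ...,
  \<open>B (q - 1)\<close> in this order. The last conjunct is what later certifies an agent without
  a bundle.\<close>

lemma while_loop_allocate:
  fixes B :: "nat \<Rightarrow> 'j set" and N :: nat
  assumes bundles: "\<And>m. m < q \<Longrightarrow> B m \<subseteq> J \<and> card (B m) = \<tau>"
    and worth: "\<And>m i. m < q \<Longrightarrow> i < N \<Longrightarrow> \<alpha> \<le> set_value F (w i) (B m)"
    and disj: "disjoint_family_on B {..<q}"
    and a: "a + q \<le> N"
    and exhausted: "\<nexists>S i. eligible F w \<alpha> \<tau> {a + q..<N} (J - (\<Union>m<q. B m)) S i"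
  shows "\<exists>A'. while_loop F w \<alpha> \<tau> ({a..<N}, J, A) ({a + q..<N}, J - (\<Union>m<q. B m), A')
           \<and> (\<forall>i\<ge>a + q. A' i = A i)"
proof -
  \<comment> \<open>Downward induction on the number \<open>p\<close> of bundles already handed out,
    because \<open>while_loop.step\<close> prepends an allocation to a run.\<close>
  have "\<exists>A'. while_loop F w \<alpha> \<tau> ({a + p..<N}, J - (\<Union>m<p. B m), A)
               ({a + q..<N}, J - (\<Union>m<q. B m), A') \<and> (\<forall>i\<ge>a + q. A' i = A i)"
    if "p \<le> q" for p
    using that
  proof (induction arbitrary: A rule: inc_induct)
    case base
    then show ?case using while_loop.stop[OF exhausted] by blast
  next
    case (step p)
    have "B p \<inter> B m = {}" if "m < p" for m
      using disj that step.hyps unfolding disjoint_family_on_def by simp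
    then have el: "eligible F w \<alpha> \<tau> {a + p..<N} (J - (\<Union>m<p. B m)) (B p) (a + p)"
      using bundles[of p] worth[of p "a + p"] step.hyps a unfolding eligible_def by auto
    have I: "{a + p..<N} - {a + p} = {a + Suc p..<N}" by auto
    have J: "J - (\<Union>m<p. B m) - B p = J - (\<Union>m<Suc p. B m)" by (auto simp: less_Suc_eq)
    obtain A' where "while_loop F w \<alpha> \<tau> ({a + Suc p..<N}, J - (\<Union>m<Suc p. B m), A(a + p \<mapsto> B p))
        ({a + q..<N}, J - (\<Union>m<q. B m), A')"
      and A': "\<forall>i\<ge>a + q. A' i = (A(a + p \<mapsto> B p)) i"
      using step.IH by blast
    then have "while_loop F w \<alpha> \<tau> ({a + p..<N}, J - (\<Union>m<p. B m), A)
        ({a + q..<N}, J - (\<Union>m<q. B m), A')"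
      using while_loop.step[OF el] unfolding I J by blast
    then show ?case using A' step.hyps by auto
  qed
  from this[of 0] show ?thesis by simp
qed

text \<open>The loop sees the values only through \<open>eligible\<close>. This allows scaled values
  to be replaced by plain weights.\<close>

lemma while_loop_eligible_cong:
  assumes "while_loop F w \<alpha> \<tau> s s'" and eq: "eligible F w \<alpha> \<tau> = eligible F w' \<alpha> \<tau>"
  shows "while_loop F w' \<alpha> \<tau> s s'"
  using assms(1)
proof induction
  case (stop I J A)
  then show ?case unfolding eq by (rule while_loop.stop)
next
  case (step I J S i A s)
  show ?case using while_loop.step[OF step.hyps(1)[unfolded eq] step.IH] .
qed

text \<open>\<open>Inv \<tau>\<close> speaks of the state after phase \<open>\<tau>\<close>, hence
  the shift by \<open>Suc\<close> in the list of phases.\<close>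

lemma for_loop_invariant:
  assumes inv_step: "\<And>\<tau> s. Inv \<tau> s \<Longrightarrow> \<exists>s'. while_loop F w \<alpha> (Suc \<tau>) s s' \<and> Inv (Suc \<tau>) s'"
    and "Inv a s" "a \<le> b"
  shows "\<exists>s'. for_loop F w \<alpha> [Suc a..<Suc b] s s' \<and> Inv b s'"
  using assms(3,2)
proof (induction arbitrary: s rule: inc_induct)
  case base
  then show ?case by simp
next
  case (step n)
  obtain t where t: "while_loop F w \<alpha> (Suc n) s t" "Inv (Suc n) t"
    using assms(1) step.prems by blast
  obtain s' where "for_loop F w \<alpha> [Suc (Suc n)..<Suc b] t s'" "Inv b s'"
    using step.IH t(2) by blast
  moreover have "[Suc n..<Suc b] = Suc n # [Suc (Suc n)..<Suc b]"
    using step.hyps by (intro upt_conv_Cons) simp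
  ultimately show ?case using t(1) by (metis for_loop.simps(2))
qed

section \<open>The instance\<close>

text \<open>Item \<open>19 * k + t\<close> with \<open>t < 19\<close> is the item of kind \<open>t\<close> in part \<open>k\<close>.\<close>

definition items :: "nat set" where "items = {..<4560}"

text \<open>The last constant is (1 - 40/107 - 20/107 - 40/963) / 16, which gives every part total
  weight 1. Fifteen such items stay below 40/107, sixteen exceed 41/107.\<close>

definition weight :: "nat \<Rightarrow> real" where
  "weight j = (let t = j mod 19 in
     if t = 0 then 40 / 107 else if t = 1 then 20 / 107 else if t = 2 then 40 / 963
     else 383 / 15408)"

definition part :: "nat \<Rightarrow> nat set" where "part k = {j. j div 19 = k}"

text \<open>For \<open>t < 4\<close> this is the least number of items of kind \<open>t\<close>
  worth more than 40/107. The least common multiple of 2, 3, 10, 16 is 240, the number of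
  parts.\<close>

definition bundle_size :: "nat \<Rightarrow> nat" where
  "bundle_size t = (if t = 0 then 2 else if t = 1 then 3 else if t = 2 then 10 else 16)"

definition transversal :: "nat \<Rightarrow> nat \<Rightarrow> nat set" where
  "transversal t m = {j. j mod 19 = t \<and> j div 19 div bundle_size t = m}"

text \<open>Of the 16 light kinds 3, ..., 18 only kind 3 occurs in transversals, so 15 light items
  per part are never allocated in the run below.\<close>

definition feasible :: "nat set set" where
  "feasible = (\<Union>k<240. Pow (part k)) \<union> (\<Union>t<4. \<Union>m<240 div bundle_size t. Pow (transversal t m))"

text \<open>In the intended run, the phase of size \<open>bundle_size t\<close> uses up kind
  \<open>t\<close> in all parts.\<close>

definition left_items :: "nat \<Rightarrow> nat set" where
  "left_items \<tau> = {j \<in> items. \<not> (j mod 19 < 4 \<and> bundle_size (j mod 19) \<le> \<tau>)}"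

definition bundle_count :: "nat \<Rightarrow> nat" where
  "bundle_count \<tau> = (\<Sum>t | t < 4 \<and> bundle_size t \<le> \<tau>. 240 div bundle_size t)"

section \<open>Arithmetic of parts and transversals\<close>

lemma less_four_cases: "(t::nat) < 4 \<Longrightarrow> t = 0 \<or> t = 1 \<or> t = 2 \<or> t = 3"
  by auto

lemma weight_nonneg: "0 \<le> weight j"
  unfolding weight_def Let_def by simp

lemma part_eq: "part k = {19 * k..<19 * k + 19}"
  unfolding part_def by auto

lemma part_eq_image: "part k = (\<lambda>t. 19 * k + t) ` {..<19}"
  unfolding part_eq lessThan_atLeast0 by (simp add: image_add_atLeastLessThan add.commute)

lemma finite_part: "finite (part k)"
  unfolding part_eq by simp

lemma transversal_eq_image:
  assumes "t < 19"
  shows "transversal t m = (\<lambda>k. 19 * k + t) ` {bundle_size t * m..<bundle_size t * m + bundle_size t}"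
proof -
  have pos: "0 < bundle_size t" unfolding bundle_size_def by simp
  have div: "k div bundle_size t = m \<longleftrightarrow> k \<in> {bundle_size t * m..<bundle_size t * m + bundle_size t}" for k
  proof -
    have "k div bundle_size t = m \<longleftrightarrow> m \<le> k div bundle_size t \<and> k div bundle_size t < Suc m" by auto
    then show ?thesis
      using pos by (simp add: less_eq_div_iff_mult_less_eq div_less_iff_less_mult algebra_simps)
  qed
  show ?thesis
  proof (intro set_eqI iffI)
    fix j assume "j \<in> transversal t m"
    then have "j = 19 * (j div 19) + t" "j div 19 div bundle_size t = m"
      unfolding transversal_def by auto
    then show "j \<in> (\<lambda>k. 19 * k + t) ` {bundle_size t * m..<bundle_size t * m + bundle_size t}"
      unfolding div by blast
  next
    fix j assume "j \<in> (\<lambda>k. 19 * k + t) ` {bundle_size t * m..<bundle_size t * m + bundle_size t}"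
    then obtain k where "j = 19 * k + t" "k div bundle_size t = m"
      using div by blast
    then show "j \<in> transversal t m" unfolding transversal_def using assms by simp
  qed
qed

lemma card_transversal: "t < 19 \<Longrightarrow> card (transversal t m) = bundle_size t"
  unfolding transversal_eq_image by (subst card_image) (auto simp: inj_on_def)

lemma sum_part: "sum weight (part k) = 1"
proof -
  have "sum weight (part k) = (\<Sum>t<19. weight (19 * k + t))"
    unfolding part_eq_image by (subst sum.reindex) (auto simp: inj_on_def)
  also have "\<dots> = (\<Sum>t<19. weight t)"
    unfolding weight_def by simp
  also have "{..<19} = insert 0 (insert 1 (insert 2 {3..<19::nat}))" by auto
  also have "sum weight \<dots> = weight 0 + weight 1 + weight 2 + sum weight {3..<19}" by simp
  also have "sum weight {3..<19} = (\<Sum>t=3..<19::nat. 383 / 15408)"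
    unfolding weight_def Let_def by (intro sum.cong) auto
  also have "weight 0 + weight 1 + weight 2 + \<dots> = 1"
    unfolding weight_def by simp
  finally show ?thesis .
qed

text \<open>The four values are 80/107, 60/107, 400/963 and 383/963. The smallest is about 42.6/107,
  so 41/107 is a convenient bound strictly above 40/107.\<close>

lemma sum_transversal:
  assumes "t < 4"
  shows "41 / 107 \<le> sum weight (transversal t m)"
proof -
  have "weight j = weight t" if "j \<in> transversal t m" for j
    using that assms unfolding transversal_def weight_def by auto
  then have "sum weight (transversal t m) = real (bundle_size t) * weight t"
    using card_transversal[of t m] assms by simp
  then show ?thesis
    using less_four_cases[OF assms] unfolding bundle_size_def weight_def by auto
qed

lemma part_subset: "k < 240 \<Longrightarrow> part k \<subseteq> items"
  unfolding part_eq items_def by auto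

lemma transversal_subset:
  assumes "t < 4" "m < 240 div bundle_size t"
  shows "transversal t m \<subseteq> items"
proof -
  have "bundle_size t * m + bundle_size t \<le> 240"
    using less_four_cases[OF assms(1)] assms(2) unfolding bundle_size_def by auto
  then show ?thesis using assms(1) by (auto simp: transversal_eq_image items_def)
qed

section \<open>The set system and its maximin partition\<close>

lemma is_partition_part: "is_partition 240 items part"
  unfolding is_partition_def disjoint_family_on_def part_def items_def by auto

lemma hereditary_feasible: "hereditary_system items feasible"
proof -
  have "feasible \<subseteq> Pow items"
    unfolding feasible_def using part_subset transversal_subset by fastforce
  moreover have "part 0 \<in> feasible" unfolding feasible_def by force
  moreover have "T \<in> feasible" if "S \<in> feasible" "T \<subseteq> S" for S T
    using that unfolding feasible_def by blast
  ultimately show ?thesis unfolding hereditary_system_def items_def by blast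
qed

lemmas feasible_finite = hereditary_system_finite[OF hereditary_feasible]

lemma set_value_part: "k < 240 \<Longrightarrow> set_value feasible weight (part k) = 1"
  using feasible_finite weight_nonneg sum_part
  by (subst set_value_feasible) (auto simp: feasible_def part_eq)

lemma sum_items: "sum weight items = 240"
proof -
  have "(\<Union>k<240. part k) = items" using is_partition_part unfolding is_partition_def by simp
  then have "sum weight items = (\<Sum>k<240. sum weight (part k))"
    by (subst sum.UNION_disjoint[symmetric]) (auto simp: finite_part, auto simp: part_def)
  then show ?thesis by (simp add: sum_part)
qed

section \<open>No valuable bundle remains after a phase\<close>

lemma left_items_weight:
  assumes "j \<in> left_items \<tau>" "0 < \<tau>"
  shows "real (min \<tau> 15) * weight j \<le> 40 / 107"
proof -
  \<comment> \<open>The heaviest remaining weight drops when kinds 0, 1, 2 disappear, at sizes 2, 3,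
    10. The bound is attained at sizes 1, 2 and 9. The cap 15 is the number of items left in a part
    from size 16 on.\<close>
  consider "\<tau> = 1" | "\<tau> = 2" | "3 \<le> \<tau>" "\<tau> \<le> 9" | "10 \<le> \<tau>" using assms(2) by linarith
  then show ?thesis
  proof cases
    case 3
    then have "weight j \<le> 40 / 963"
      using assms(1) unfolding left_items_def weight_def bundle_size_def Let_def
      by (auto split: if_splits)
    then have "real (min \<tau> 15) * weight j \<le> 9 * (40 / 963)"
      using 3 weight_nonneg by (intro mult_mono) auto
    then show ?thesis by simp
  next
    case 4
    then have "weight j \<le> 383 / 15408"
      using assms(1) unfolding left_items_def weight_def bundle_size_def Let_def
      by (auto split: if_splits)
    then have "real (min \<tau> 15) * weight j \<le> 15 * (383 / 15408)"
      using weight_nonneg by (intro mult_mono) auto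
    then show ?thesis by simp
  qed (use assms(1) in \<open>auto simp: left_items_def weight_def bundle_size_def Let_def split: if_splits\<close>)
qed

lemma card_part_left_items: "16 \<le> \<tau> \<Longrightarrow> card (part k \<inter> left_items \<tau>) \<le> 15"
proof -
  assume "16 \<le> \<tau>"
  then have "part k \<inter> left_items \<tau> \<subseteq> {19 * k + 4..<19 * k + 19}"
    unfolding part_def left_items_def bundle_size_def by (auto split: if_splits; presburger)
  from card_mono[OF _ this] show ?thesis by simp
qed

text \<open>\<open>T\<close> has at most \<open>min \<tau> 15\<close> items: below 16 by its
  cardinality bound, afterwards because a part retains 15 items and the transversals are exhausted.
  Multiplying by the largest remaining weight gives the bound.\<close>

lemma feasible_left_items_sum:
  assumes T: "T \<in> feasible" "T \<subseteq> left_items \<tau>" "card T \<le> \<tau>" and "0 < \<tau>"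
  shows "sum weight T \<le> 40 / 107"
proof -
  have card: "card T \<le> min \<tau> 15"
  proof (cases "16 \<le> \<tau>")
    case True
    consider k where "T \<subseteq> part k" | t m where "t < 4" "T \<subseteq> transversal t m"
      using T(1) unfolding feasible_def by auto
    then show ?thesis
    proof cases
      case 1
      then have "card T \<le> card (part k \<inter> left_items \<tau>)"
        using T(2) by (intro card_mono) (auto simp: part_eq)
      then show ?thesis using card_part_left_items[OF True, of k] True by linarith
    next
      case 2
      then have "T = {}"
        using T(2) True unfolding left_items_def transversal_def bundle_size_def
        by (fastforce split: if_splits)
      then show ?thesis by simp
    qed
  qed (use T(3) in auto)
  let ?c = "real (min \<tau> 15)"
  have c: "0 < ?c" using \<open>0 < \<tau>\<close> by simp
  have "sum weight T \<le> real (card T) * (40 / 107 / ?c)"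
    using left_items_weight[OF _ \<open>0 < \<tau>\<close>] T(2) c
    by (intro sum_bounded_above) (auto simp: field_simps)
  also have "\<dots> \<le> ?c * (40 / 107 / ?c)"
    using card c by (intro mult_right_mono) auto
  also have "\<dots> = 40 / 107" using c by simp
  finally show ?thesis .
qed

text \<open>This is the stopping condition of the loop: the value of \<open>S\<close> is attained by
  a feasible subset with at most \<open>\<tau>\<close> items.\<close>

lemma not_eligible:
  assumes "40 / 107 < \<alpha>" "0 < \<tau>"
  shows "\<not> eligible feasible (\<lambda>_. weight) \<alpha> \<tau> I (left_items \<tau>) S i"
proof
  assume "eligible feasible (\<lambda>_. weight) \<alpha> \<tau> I (left_items \<tau>) S i"
  then have S: "S \<subseteq> left_items \<tau>" "card S = \<tau>" "\<alpha> \<le> set_value feasible weight S"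
    unfolding eligible_def by auto
  obtain T where T: "T \<in> feasible" "T \<subseteq> S" "set_value feasible weight S = sum weight T"
    using set_value_attained[OF feasible_finite(2,3)] .
  have "finite S" using S(2) assms(2) by (simp add: card_ge_0_finite)
  then have "card T \<le> \<tau>" using T(2) S(2) card_mono by blast
  then have "sum weight T \<le> 40 / 107"
    using feasible_left_items_sum T(1,2) S(1) assms(2) by blast
  then show False using S(3) T(3) assms(1) by simp
qed

section \<open>The run that leaves an agent unserved\<close>

lemma bundle_count_le: "bundle_count \<tau> \<le> 239"
proof -
  have "bundle_count \<tau> \<le> (\<Sum>t<4. 240 div bundle_size t)"
    unfolding bundle_count_def by (intro sum_mono2) auto
  also have "{..<4} = {0, 1, 2, 3::nat}" by auto
  \<comment> \<open>The count is 120 + 80 + 24 + 15, one less than the number of agents.\<close>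
  also have "(\<Sum>t\<in>\<dots>. 240 div bundle_size t) = 239" unfolding bundle_size_def by simp
  finally show ?thesis .
qed

lemma bundle_size_inj: "t < 4 \<Longrightarrow> t' < 4 \<Longrightarrow> bundle_size t = bundle_size t' \<Longrightarrow> t = t'"
  unfolding bundle_size_def by (auto split: if_splits)

text \<open>If the phase size is some \<open>bundle_size t\<close>, all transversals of kind
  \<open>t\<close> go to the next agents; otherwise the state does not change. In both cases
  \<open>not_eligible\<close> ends the loop.\<close>

lemma phase:
  assumes \<alpha>: "40 / 107 < \<alpha>" "\<alpha> \<le> 41 / 107"
  shows "\<exists>A'. while_loop feasible (\<lambda>_. weight) \<alpha> (Suc \<tau>)
           ({bundle_count \<tau>..<240}, left_items \<tau>, A)
           ({bundle_count (Suc \<tau>)..<240}, left_items (Suc \<tau>), A')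
         \<and> (\<forall>i\<ge>bundle_count (Suc \<tau>). A' i = A i)"
proof (cases "\<exists>t<4. bundle_size t = Suc \<tau>")
  case True
  then obtain t where t: "t < 4" "bundle_size t = Suc \<tau>" by blast
  let ?q = "240 div bundle_size t"
  have "{t'. t' < 4 \<and> bundle_size t' \<le> Suc \<tau>} = insert t {t'. t' < 4 \<and> bundle_size t' \<le> \<tau>}"
    using t bundle_size_inj by (auto simp: le_Suc_eq)
  then have count: "bundle_count (Suc \<tau>) = bundle_count \<tau> + ?q"
    unfolding bundle_count_def using t(2) by simp
  \<comment> \<open>As the bundle size divides 240, the transversals cover every item of kind
    \<open>t\<close>, with no incomplete block left over.\<close>
  have range: "j div 19 div bundle_size t < ?q" if "j < 4560" for j
    using that less_four_cases[OF t(1)] unfolding bundle_size_def by auto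
  have left: "left_items (Suc \<tau>) = left_items \<tau> - (\<Union>m<?q. transversal t m)"
  proof -
    have "j mod 19 < 4 \<and> bundle_size (j mod 19) \<le> Suc \<tau> \<longleftrightarrow>
        (j mod 19 < 4 \<and> bundle_size (j mod 19) \<le> \<tau>) \<or> j mod 19 = t" for j
      using t bundle_size_inj by (auto simp: le_Suc_eq)
    then show ?thesis unfolding left_items_def transversal_def items_def using range by auto
  qed
  \<comment> \<open>The transversals are still intact: their bundle size exceeds
    \<open>\<tau>\<close>, so no earlier phase removed their kind.\<close>
  have "transversal t m \<subseteq> left_items \<tau> \<and> card (transversal t m) = Suc \<tau>" if "m < ?q" for m
    using transversal_subset[OF t(1) that] card_transversal[of t m] t
    unfolding left_items_def transversal_def by auto
  moreover have "\<alpha> \<le> set_value feasible weight (transversal t m)" if "m < ?q" for m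
  proof -
    have "transversal t m \<in> feasible" unfolding feasible_def using t(1) that by blast
    then have "sum weight (transversal t m) \<le> set_value feasible weight (transversal t m)"
      using sum_le_set_value feasible_finite(2) by blast
    then show ?thesis using sum_transversal[OF t(1), of m] \<alpha>(2) by linarith
  qed
  moreover have "disjoint_family_on (transversal t) {..<?q}"
    unfolding disjoint_family_on_def transversal_def by auto
  moreover have "bundle_count \<tau> + ?q \<le> 240"
    using bundle_count_le[of "Suc \<tau>"] count by linarith
  moreover have "\<nexists>S i. eligible feasible (\<lambda>_. weight) \<alpha> (Suc \<tau>) {bundle_count \<tau> + ?q..<240}
      (left_items \<tau> - (\<Union>m<?q. transversal t m)) S i"
    using not_eligible[OF \<alpha>(1), of "Suc \<tau>"] left by fastforce
  ultimately show ?thesis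
    unfolding count left by (intro while_loop_allocate)
next
  case False
  then have *: "t < 4 \<Longrightarrow> bundle_size t \<le> Suc \<tau> \<longleftrightarrow> bundle_size t \<le> \<tau>" for t
    by (auto simp: le_Suc_eq)
  then have "bundle_count (Suc \<tau>) = bundle_count \<tau>" "left_items (Suc \<tau>) = left_items \<tau>"
    unfolding bundle_count_def left_items_def by (auto intro: sum.cong)
  then show ?thesis using while_loop.stop not_eligible[OF \<alpha>(1), of "Suc \<tau>"]
    by (metis zero_less_Suc)
qed

lemma procedure_run:
  assumes "40 / 107 < \<alpha>" "\<alpha> \<le> 41 / 107"
  shows "\<exists>I' J' A. for_loop feasible (\<lambda>_. weight) \<alpha> [1..<Suc b] ({..<240::nat}, items, Map.empty) (I', J', A)
           \<and> A 239 = None"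
proof -
  \<comment> \<open>The state is tracked exactly. Agent 239 stays unserved because
    \<open>bundle_count\<close> never exceeds 239.\<close>
  define Inv where "Inv \<tau> s \<longleftrightarrow>
      (\<exists>A. s = ({bundle_count \<tau>..<240}, left_items \<tau>, A) \<and> A 239 = None)"
    for \<tau> and s :: "(nat, nat) state"
  have "\<exists>s'. while_loop feasible (\<lambda>_. weight) \<alpha> (Suc \<tau>) s s' \<and> Inv (Suc \<tau>) s'" if inv: "Inv \<tau> s" for \<tau> s
  proof -
    obtain A where s: "s = ({bundle_count \<tau>..<240}, left_items \<tau>, A)" and A: "A 239 = None"
      using inv unfolding Inv_def by blast
    obtain A' where "while_loop feasible (\<lambda>_. weight) \<alpha> (Suc \<tau>) s
        ({bundle_count (Suc \<tau>)..<240}, left_items (Suc \<tau>), A')"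
      and "\<forall>i\<ge>bundle_count (Suc \<tau>). A' i = A i"
      using phase[OF assms] unfolding s by blast
    moreover from this(2) have "A' 239 = None" using A bundle_count_le by simp
    ultimately show ?thesis unfolding Inv_def by blast
  qed
  moreover have "Inv 0 ({..<240}, items, Map.empty)"
  proof -
    have "\<not> bundle_size t \<le> 0" for t unfolding bundle_size_def by simp
    then show ?thesis unfolding Inv_def bundle_count_def left_items_def by auto
  qed
  ultimately have "\<exists>s'. for_loop feasible (\<lambda>_. weight) \<alpha> [Suc 0..<Suc b] ({..<240}, items, Map.empty) s'
      \<and> Inv b s'"
    using for_loop_invariant[of Inv feasible "\<lambda>_. weight" \<alpha> 0] by blast
  then show ?thesis unfolding Inv_def One_nat_def by blast
qed

theorem theorem4:
  "\<exists>\<epsilon>\<^sub>0>0::real. \<forall>\<epsilon>. 0 < \<epsilon> \<and> \<epsilon> < \<epsilon>\<^sub>0 \<longrightarrow>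
     (\<exists>(I :: nat set) (J :: nat set) F v P A.
        hereditary_instance I J F v \<and>
        (\<forall>i\<in>I. MMS (card I) J F (v i) = 1) \<and>
        (\<forall>i\<in>I. maximin_partition (card I) J F (v i) (P i)) \<and>
        valid_execution I J F v P (40 / 107 + \<epsilon>) A \<and>
        (\<exists>i\<in>I. A i = None))"
proof (intro exI[of _ "1 / 107"] conjI allI impI)
  fix \<epsilon> :: real
  \<comment> \<open>The bound 1/107 keeps the target below 41/107, within reach of every
    transversal.\<close>
  assume \<epsilon>: "0 < \<epsilon> \<and> \<epsilon> < 1 / 107"
  let ?I = "{..<240::nat}" and ?\<alpha> = "40 / 107 + \<epsilon>"
  have inst: "hereditary_instance ?I items feasible (\<lambda>_. weight)"
    unfolding hereditary_instance_def using hereditary_feasible weight_nonneg by simp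
  have mms: "MMS 240 items feasible weight = 1"
    and maximin: "maximin_partition 240 items feasible weight part"
    using MMS_eqI[OF hereditary_feasible weight_nonneg _ is_partition_part set_value_part]
      sum_items by simp_all
  have "scaled_value 240 feasible weight part j = weight j" if "j \<in> items" for j
    using scaled_value_unit_parts[OF is_partition_part, of feasible weight j] set_value_part that
    by simp
  \<comment> \<open>Scaled values are unspecified outside \<open>items\<close>, but feasible sets
    contain only items, so the set values agree everywhere.\<close>
  then have "set_value feasible (scaled_value 240 feasible weight part) = set_value feasible weight"
    using hereditary_feasible unfolding hereditary_system_def by (intro ext set_value_cong) auto
  then have el: "eligible feasible (\<lambda>_. scaled_value 240 feasible weight part) =
      eligible feasible (\<lambda>_. weight)"
    unfolding eligible_def by (intro ext) simp
  have "while_loop feasible (\<lambda>_. scaled_value 240 feasible weight part) \<alpha> \<tau> s s'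
      \<longleftrightarrow> while_loop feasible (\<lambda>_. weight) \<alpha> \<tau> s s'"
    for \<alpha> \<tau> and s s' :: "(nat, nat) state"
    using while_loop_eligible_cong el by metis
  then have "for_loop feasible (\<lambda>_. scaled_value 240 feasible weight part) \<alpha> \<tau>s s s'
      \<longleftrightarrow> for_loop feasible (\<lambda>_. weight) \<alpha> \<tau>s s s'"
    for \<alpha> \<tau>s and s s' :: "(nat, nat) state"
    by (induction \<tau>s arbitrary: s) simp_all
  moreover obtain I' J' A where
    "for_loop feasible (\<lambda>_. weight) ?\<alpha> [1..<Suc (card items)] (?I, items, Map.empty) (I', J', A)"
    and A: "A 239 = None"
    using procedure_run[of ?\<alpha> "card items"] \<epsilon> by fastforce
  ultimately have "valid_execution ?I items feasible (\<lambda>_. weight) (\<lambda>_. part) ?\<alpha> A"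
    unfolding valid_execution_def card_lessThan using maximin by blast
  then show "\<exists>(I :: nat set) (J :: nat set) F v P A.
        hereditary_instance I J F v \<and>
        (\<forall>i\<in>I. MMS (card I) J F (v i) = 1) \<and>
        (\<forall>i\<in>I. maximin_partition (card I) J F (v i) (P i)) \<and>
        valid_execution I J F v P (40 / 107 + \<epsilon>) A \<and>
        (\<exists>i\<in>I. A i = None)"
    using inst mms maximin A
    by (intro exI[of _ ?I] exI[of _ items] exI[of _ feasible] exI[of _ "\<lambda>_. weight"]
        exI[of _ "\<lambda>_. part"] exI[of _ A]) auto
qed simp

end
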